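(* Let $\Gamma$ be a Feynman graph with $n$ internal edges and $\ell=b_1(\Gamma)$ loops, and assume that the linear map $\tau=\tau_\Gamma:\mathbb{A}^n\to\mathbb{A}^{\ell^2}$, $\tau(t)=\eta^\dagger\Lambda\eta$, is injective. Then the parametric Feynman integral $$\int_{\sigma_n}\frac{P_\Gamma(t,p)^{-n+D\ell/2}\,\omega_n}{\Psi_\Gamma(t)^{-n+(\ell+1)D/2}}$$ can be rewritten in the form $$\int_{\tau(\sigma_n)}\frac{\mathcal{P}_\Gamma(p,x)^{-n+D\ell/2}\,\omega_\Gamma(x)}{\det(x)^{-n+(\ell+1)D/2}},$$ where $\mathcal{P}_\Gamma(p,x)$ is a homogeneous polynomial on the space $\mathbb{A}^{\ell^2}$ of $\ell\times\ell$ matrices $x$ whose restriction to the image of $\mathbb{A}^n$ under $\tau$ agrees with $P_\Gamma(t,p)$ (i.e. $\mathcal{P}_\Gamma(p,\tau(t))=P_\Gamma(t,p)$), and $\omega_\Gamma$ is the induced volume form (the volume form on $\tau(\mathbb{A}^n)$ corresponding to $\omega_n$ under $\tau$).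
   Context: A Feynman graph $\Gamma$ is a finite connected graph (multigraphs allowed) with a set of internal edges $e_1,\dots,e_n$, each joining two vertices, and a set of external edges, each attached to one vertex, such that $\Gamma$ cannot be disconnected by removing a single internal edge. Each external edge $e$ carries a momentum $p_e\in\mathbb{Q}^D$ with $\sum_e p_e=0$; for a vertex $v$ let $P_v$ be the sum of the $p_e$ over external edges attached to $v$. $D$ is a positive integer (the spacetime dimension), taken in the range $n\le D\ell/2$. The number of loops is $\ell=b_1(\Gamma)$, the rank of $H_1(\Gamma,\mathbb{Z})$. $\sigma_n=\{t\in\mathbb{R}_+^n: \sum_i t_i=1\}$, and $\omega_n$ is the volume form on it. $\Psi_\Gamma(t)=\sum_{T}\prod_{e\notin E(T)}t_e$, the sum over spanning trees $T$ of $\Gamma$. $P_\Gamma(t,p)=\sum_C s_C\prod_{e\in C}t_e$, the sum over cut-sets $C$, i.e. collections of $\ell+1$ internal edges whose removal divides $\Gamma$ into exactly two connected components $\Gamma_1,\Gamma_2$, with $s_C=\left(\sum_{v\in V(\Gamma_1)}P_v\right)^2=\left(\sum_{v\in V(\Gamma_2)}P_v\right)^2$. Fix orientations of the edges and a basis $l_1,\dots,l_\ell$ of $H_1(\Gamma,\mathbb{Z})$ given by oriented loops. The $n\times\ell$ matrix $\eta=(\eta_{ik})$ has $\eta_{ik}=+1$ (resp. $-1$) if the edge $e_i$ belongs to the loop $l_k$ with the same (resp. reverse) orientation and $\eta_{ik}=0$ otherwise. $\Lambda$ is the diagonal matrix with diagonal entries $t_1,\dots,t_n$, and $\tau(t)=M_\Gamma(t)=\eta^\dagger\Lambda\eta$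 ($\dagger$ = transpose). It is known that $\Psi_\Gamma(t)=\det M_\Gamma(t)$. Integrals are considered modulo the issue of divergence (i.e. the identity is understood when the integrals converge). *)

theory Defs
  imports "HOL-Analysis.Analysis" "HOL-Library.Poly_Mapping" "Graph_Theory.Digraph_Component"
begin

text \<open>
  A multigraph with chosen edge orientations is a \<open>pre_digraph\<close>. The internal edges form the whole
  finite type \<open>'e\<close>, so that \<open>n = CARD('e)\<close> and points of affine \<open>n\<close>-space are vectors \<open>real^'e\<close>.
  Self-loops are allowed. The constant \<open>Digraph_Component.connected\<close> is connectedness of the
  underlying undirected graph.
\<close>

definition remove_edges :: "('v, 'e) pre_digraph \<Rightarrow> 'e set \<Rightarrow> ('v, 'e) pre_digraph" where
  "remove_edges \<Gamma> C = \<Gamma>\<lparr>arcs := arcs \<Gamma> - C\<rparr>"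

definition feynman_graph ::
    "('v, 'e::finite) pre_digraph \<Rightarrow> 'x set \<Rightarrow> ('x \<Rightarrow> 'v) \<Rightarrow> bool" where
  "feynman_graph \<Gamma> X att \<longleftrightarrow>
     fin_digraph \<Gamma> \<and> arcs \<Gamma> = UNIV \<and> Digraph_Component.connected \<Gamma> \<and>
     (\<forall>e. Digraph_Component.connected (remove_edges \<Gamma> {e})) \<and>
     finite X \<and> att ` X \<subseteq> verts \<Gamma>"

text \<open>Vertex sets of the connected components of the underlying undirected graph.\<close>

definition components :: "('v, 'e) pre_digraph \<Rightarrow> 'v set set" where
  "components \<Gamma> = pre_digraph.sccs_verts (with_proj (mk_symmetric \<Gamma>))"


section \<open>Oriented loops and first homology\<close>

text \<open>
  The pair \<open>(e, True)\<close> is the edge \<open>e\<close> run through from tail to head, \<open>(e, False)\<close> the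
  same edge run through backwards.
\<close>

definition step_src :: "('v, 'e) pre_digraph \<Rightarrow> 'e \<times> bool \<Rightarrow> 'v" where
  "step_src \<Gamma> d = (if snd d then tail \<Gamma> (fst d) else head \<Gamma> (fst d))"

definition step_tgt :: "('v, 'e) pre_digraph \<Rightarrow> 'e \<times> bool \<Rightarrow> 'v" where
  "step_tgt \<Gamma> d = (if snd d then head \<Gamma> (fst d) else tail \<Gamma> (fst d))"

text \<open>A nonempty closed walk using each edge at most once.\<close>

definition oriented_loop :: "('v, 'e) pre_digraph \<Rightarrow> ('e \<times> bool) list \<Rightarrow> bool" where
  "oriented_loop \<Gamma> ds \<longleftrightarrow>
     ds \<noteq> [] \<and> fst ` set ds \<subseteq> arcs \<Gamma> \<and> distinct (map fst ds) \<and>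
     (\<forall>i < length ds. step_tgt \<Gamma> (ds ! i) = step_src \<Gamma> (ds ! ((i + 1) mod length ds)))"

definition loop_chain :: "('e \<times> bool) list \<Rightarrow> int ^ 'e::finite" where
  "loop_chain ds =
     (\<chi> e. if (e, True) \<in> set ds then 1 else if (e, False) \<in> set ds then -1 else 0)"

text \<open>
  The group \<open>H\<^sub>1(\<Gamma>, \<int>)\<close> is the kernel of the cellular boundary map
  from 1-chains to 0-chains, since a graph has no 2-cells.
\<close>

definition boundary :: "('v, 'e::finite) pre_digraph \<Rightarrow> int ^ 'e \<Rightarrow> 'v \<Rightarrow> int" where
  "boundary \<Gamma> c v =
     (\<Sum>e\<in>arcs \<Gamma>. c $ e * (of_bool (head \<Gamma> e = v) - of_bool (tail \<Gamma> e = v)))"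

definition H1 :: "('v, 'e::finite) pre_digraph \<Rightarrow> (int ^ 'e) set" where
  "H1 \<Gamma> = {c. (\<forall>e. e \<notin> arcs \<Gamma> \<longrightarrow> c $ e = 0) \<and> (\<forall>v\<in>verts \<Gamma>. boundary \<Gamma> c v = 0)}"

text \<open>
  The rank of the free abelian group \<open>H\<^sub>1(\<Gamma>, \<int>)\<close>, as the dimension of its
  rational span.
\<close>

definition loop_number :: "('v, 'e::finite) pre_digraph \<Rightarrow> nat" where
  "loop_number \<Gamma> = vec.dim ((\<lambda>c. (\<chi> e. of_int (c $ e)) :: rat ^ 'e) ` H1 \<Gamma>)"

definition loop_basis ::
    "('v, 'e::finite) pre_digraph \<Rightarrow> ('l::finite \<Rightarrow> ('e \<times> bool) list) \<Rightarrow> bool" where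
  "loop_basis \<Gamma> L \<longleftrightarrow>
     (\<forall>k. oriented_loop \<Gamma> (L k)) \<and>
     (\<forall>c\<in>H1 \<Gamma>. \<exists>!a :: 'l \<Rightarrow> int. c = (\<Sum>k\<in>UNIV. a k *s loop_chain (L k)))"

definition eta :: "('l::finite \<Rightarrow> ('e \<times> bool) list) \<Rightarrow> real ^ 'l ^ 'e::finite" where
  "eta L = (\<chi> i k. of_int (loop_chain (L k) $ i))"

definition tau ::
    "('l::finite \<Rightarrow> ('e \<times> bool) list) \<Rightarrow> real ^ 'e::finite \<Rightarrow> real ^ 'l ^ 'l" where
  "tau L t = transpose (eta L) ** (\<chi> i j. if i = j then t $ i else 0) ** eta L"


section \<open>Graph polynomials\<close>

text \<open>
  The predicate \<open>forest\<close> of the graph library only excludes directed cycles, so acyclicity of the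
  underlying undirected graph is expressed here through \<open>oriented_loop\<close>.
\<close>

definition spanning_tree_edges :: "('v, 'e) pre_digraph \<Rightarrow> 'e set \<Rightarrow> bool" where
  "spanning_tree_edges \<Gamma> T \<longleftrightarrow>
     T \<subseteq> arcs \<Gamma> \<and> Digraph_Component.connected (\<Gamma>\<lparr>arcs := T\<rparr>) \<and>
     \<not> (\<exists>ds. oriented_loop (\<Gamma>\<lparr>arcs := T\<rparr>) ds)"

definition Psi :: "('v, 'e::finite) pre_digraph \<Rightarrow> real ^ 'e \<Rightarrow> real" where
  "Psi \<Gamma> t = (\<Sum>T | spanning_tree_edges \<Gamma> T. \<Prod>e\<in>arcs \<Gamma> - T. t $ e)"

definition cut_set :: "('v, 'e::finite) pre_digraph \<Rightarrow> 'e set \<Rightarrow> bool" where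
  "cut_set \<Gamma> C \<longleftrightarrow>
     C \<subseteq> arcs \<Gamma> \<and> card C = loop_number \<Gamma> + 1 \<and> card (components (remove_edges \<Gamma> C)) = 2"

text \<open>External edges form the set \<open>X\<close>; \<open>att\<close> gives the vertex an external edge is attached to.\<close>

definition vertex_momentum ::
    "'x set \<Rightarrow> ('x \<Rightarrow> 'v) \<Rightarrow> ('x \<Rightarrow> rat ^ 'd::finite) \<Rightarrow> 'v \<Rightarrow> rat ^ 'd" where
  "vertex_momentum X att p v = (\<Sum>e | e \<in> X \<and> att e = v. p e)"

definition momentum_square :: "rat ^ 'd::finite \<Rightarrow> rat" where
  "momentum_square q = (\<Sum>i\<in>UNIV. (q $ i)\<^sup>2)"

text \<open>
  By momentum conservation the two components left by a cut-set give the same value (lemma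
  \<open>cut_coeff_eq\<close> below), so either of them may be used.
\<close>

definition cut_coeff ::
    "('v, 'e::finite) pre_digraph \<Rightarrow> 'x set \<Rightarrow> ('x \<Rightarrow> 'v) \<Rightarrow> ('x \<Rightarrow> rat ^ 'd::finite) \<Rightarrow> 'e set \<Rightarrow> rat" where
  "cut_coeff \<Gamma> X att p C =
     momentum_square
       (\<Sum>v\<in>(SOME S. S \<in> components (remove_edges \<Gamma> C)). vertex_momentum X att p v)"

definition P_poly ::
    "('v, 'e::finite) pre_digraph \<Rightarrow> 'x set \<Rightarrow> ('x \<Rightarrow> 'v) \<Rightarrow> ('x \<Rightarrow> rat ^ 'd::finite) \<Rightarrow> real ^ 'e \<Rightarrow> real" where
  "P_poly \<Gamma> X att p t =
     (\<Sum>C | cut_set \<Gamma> C. of_rat (cut_coeff \<Gamma> X att p C) * (\<Prod>e\<in>C. t $ e))"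

lemma components_partition:
  assumes "wf_digraph \<Gamma>"
  shows "\<Union>(components \<Gamma>) = verts \<Gamma>"
    and "S \<in> components \<Gamma> \<Longrightarrow> S' \<in> components \<Gamma> \<Longrightarrow> S \<noteq> S' \<Longrightarrow> S \<inter> S' = {}"
proof -
  interpret S: pair_wf_digraph "mk_symmetric \<Gamma>"
    using assms by (rule wf_digraph.wellformed_mk_symmetric)
  show "S \<in> components \<Gamma> \<Longrightarrow> S' \<in> components \<Gamma> \<Longrightarrow> S \<noteq> S' \<Longrightarrow> S \<inter> S' = {}"
    unfolding components_def by (rule S.sccs_verts_disjoint)
  show "\<Union>(components \<Gamma>) = verts \<Gamma>"
  proof
    show "\<Union>(components \<Gamma>) \<subseteq> verts \<Gamma>"
      unfolding components_def using S.sccs_verts_subsets by fastforce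
    show "verts \<Gamma> \<subseteq> \<Union>(components \<Gamma>)"
    proof
      fix v assume v: "v \<in> verts \<Gamma>"
      have "S.scc_of v \<in> S.sccs_verts"
        using v by (intro S.scc_of_in_sccs_verts) simp
      moreover have "v \<in> S.scc_of v"
        using v by (simp add: S.scc_of_def)
      ultimately show "v \<in> \<Union>(components \<Gamma>)"
        unfolding components_def by blast
    qed
  qed
qed

lemma cut_coeff_eq:
  assumes "feynman_graph \<Gamma> X att" and "(\<Sum>e\<in>X. p e) = 0"
    and "cut_set \<Gamma> C" and "S \<in> components (remove_edges \<Gamma> C)"
  shows "cut_coeff \<Gamma> X att p C = momentum_square (\<Sum>v\<in>S. vertex_momentum X att p v)"
proof -
  let ?P = "vertex_momentum X att p"
  have fin: "fin_digraph \<Gamma>" and X: "finite X" "att ` X \<subseteq> verts \<Gamma>"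
    using assms(1) by (auto simp: feynman_graph_def)
  interpret fin_digraph \<Gamma> by (rule fin)
  have wf: "wf_digraph (remove_edges \<Gamma> C)"
    by unfold_locales (auto simp: remove_edges_def)
  note part = components_partition[OF wf]
  define S0 where "S0 = (SOME S. S \<in> components (remove_edges \<Gamma> C))"
  have S0: "S0 \<in> components (remove_edges \<Gamma> C)"
    unfolding S0_def using assms(4) by (rule someI)
  have "momentum_square (sum ?P S0) = momentum_square (sum ?P S)"
  proof (cases "S0 = S")
    case False
    have "finite (components (remove_edges \<Gamma> C))"
      using assms(3) by (intro card_ge_0_finite) (simp add: cut_set_def)
    then have "components (remove_edges \<Gamma> C) = {S0, S}"
      using assms(3,4) S0 False card_subset_eq[of "components (remove_edges \<Gamma> C)" "{S0, S}"]
      by (auto simp: cut_set_def)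
    then have un: "S0 \<union> S = verts \<Gamma>"
      using part(1) by (simp add: remove_edges_def)
    have "finite S0" "finite S"
      using un finite_verts by (metis finite_Un)+
    then have "sum ?P S0 + sum ?P S = sum ?P (verts \<Gamma>)"
      using part(2)[OF S0 assms(4) False] un by (metis sum.union_disjoint)
    also have "\<dots> = (\<Sum>e\<in>X. p e)"
      unfolding vertex_momentum_def using X by (intro sum.group) auto
    finally have "sum ?P S0 = - sum ?P S"
      using assms(2) by (simp add: eq_neg_iff_add_eq_0)
    then show ?thesis
      by (simp add: momentum_square_def)
  qed simp
  then show ?thesis
    by (simp add: cut_coeff_def S0_def)
qed


section \<open>Polynomials on the space of matrices\<close>

text \<open>
  Polynomials in matrix entries \<open>x\<^sub>i\<^sub>j\<close> are finitely supported coefficient functions on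
  exponent vectors.
\<close>

type_synonym 'l matrix_poly = "('l \<times> 'l \<Rightarrow>\<^sub>0 nat) \<Rightarrow>\<^sub>0 real"

definition eval_matrix_poly :: "'l::finite matrix_poly \<Rightarrow> real ^ 'l ^ 'l \<Rightarrow> real" where
  "eval_matrix_poly q x =
     (\<Sum>m\<in>Poly_Mapping.keys q. Poly_Mapping.lookup q m *
        (\<Prod>(i, j)\<in>UNIV. (x $ i $ j) ^ Poly_Mapping.lookup m (i, j)))"

definition homogeneous_matrix_poly :: "'l::finite matrix_poly \<Rightarrow> bool" where
  "homogeneous_matrix_poly q \<longleftrightarrow>
     (\<exists>d. \<forall>m\<in>Poly_Mapping.keys q. (\<Sum>ij\<in>UNIV. Poly_Mapping.lookup m ij) = d)"


section \<open>Volume forms and integrands\<close>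

definition sigma_simplex :: "(real ^ 'e::finite) set" where
  "sigma_simplex = {t. (\<forall>i. 0 \<le> t $ i) \<and> (\<Sum>i\<in>UNIV. t $ i) = 1}"

text \<open>
  Integration against the volume form \<open>\<omega>\<^sub>n\<close> is integration against a measure. On the hyperplane
  where the coordinates sum to 1, the coordinates \<open>t\<^sub>i\<close> with \<open>i \<noteq> e0\<close> are a global chart in which
  \<open>\<omega>\<^sub>n\<close> is the product of the \<open>dt\<^sub>i\<close>. The form does not depend on \<open>e0\<close> up to sign.
\<close>

definition omega_n :: "'e::finite \<Rightarrow> (real ^ 'e) measure" where
  "omega_n e0 =
     distr (\<Pi>\<^sub>M i\<in>UNIV - {e0}. lborel) borel
       (\<lambda>u. \<chi> i. if i = e0 then 1 - (\<Sum>j\<in>UNIV - {e0}. u j) else u i)"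

text \<open>
  The volume form on the image of \<open>\<tau>\<close> whose pullback along \<open>\<tau>\<close> is \<open>\<omega>\<^sub>n\<close>; at the level of
  measures this is the image measure.
\<close>

definition omega_Gamma ::
    "('l::finite \<Rightarrow> ('e::finite \<times> bool) list) \<Rightarrow> 'e \<Rightarrow> (real ^ 'l ^ 'l) measure" where
  "omega_Gamma L e0 = distr (omega_n e0) borel (tau L)"

text \<open>
  In the library \<open>0 powr 0 = 0\<close>, whereas the numerator of the integrand is 1 when its exponent
  vanishes, even where its base does.
\<close>

definition rpow :: "real \<Rightarrow> real \<Rightarrow> real" where
  "rpow x a = (if a = 0 then 1 else x powr a)"

end

theory Submission
  imports Defs
begin

text \<open>
  The identity is a change of variables along \<open>\<tau>\<close>. Since \<open>\<tau>\<close> is linear and injective it has a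
  linear left inverse, and composing \<open>P\<^sub>\<Gamma>\<close> with that inverse turns every monomial of \<open>P\<^sub>\<Gamma>\<close> into a
  product of \<open>\<ell> + 1\<close> linear forms in the matrix entries; this is the homogeneous polynomial sought
  (\<open>P_poly_factors_through_tau\<close>). The measure on the image is by definition the image
  measure, so the two integrals agree once both factors of the integrand are pulled back correctly
  (\<open>set_integral_image_measure\<close>). For the numerator this is the choice of the polynomial; for the
  denominator it is Kirchhoff's identity \<open>\<Psi>\<^sub>\<Gamma>(t) = det (\<eta>\<^sup>T \<Lambda> \<eta>)\<close> (\<open>Psi_eq_det_tau\<close>),
  which is the bulk of the work.

  Kirchhoff's identity is obtained from the Cauchy--Binet expansion
  \<open>det (\<eta>\<^sup>T \<Lambda> \<eta>) = \<Sum>\<^sub>S (\<Prod>\<^sub>e\<^sub>\<in>\<^sub>S t\<^sub>e) (det \<eta>\<^sub>S)\<^sup>2\<close> over the sets \<open>S\<close> of \<open>\<ell>\<close> edges (\<open>det_weighted_gram\<close>).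
  It has to be seen that \<open>det \<eta>\<^sub>S = \<plusminus>1\<close> if the complement of \<open>S\<close> is a spanning tree, and
  \<open>det \<eta>\<^sub>S = 0\<close> otherwise (\<open>det_rows_of_eta_squared\<close>).

  If \<open>T = - S\<close> is a spanning tree, every \<open>e \<in> S\<close> closes up to a fundamental cycle, which meets
  \<open>S\<close> in \<open>e\<close> alone. The coordinates of these cycles in the given basis of \<open>H\<^sub>1\<close> form an integer
  matrix inverse to \<open>\<eta>\<^sub>S\<close>. An inverse over the integers forces the determinant to be a unit, and
  comparing the traces of the two products gives \<open>|S| = \<ell>\<close>.

  If \<open>T\<close> contains a loop, its coordinates are a nonzero vector in the kernel of \<open>\<eta>\<^sub>S\<close>. If \<open>T\<close> is
  disconnected, a cut of \<open>\<Gamma>\<close> consists of edges in \<open>S\<close> only, and since the signed sum of a cycle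
  over any cut vanishes, the rows of \<open>\<eta>\<^sub>S\<close> are dependent.
\<close>

section \<open>Walks, trails and connectedness\<close>

fun walk :: "('v, 'e) pre_digraph \<Rightarrow> 'v \<Rightarrow> ('e \<times> bool) list \<Rightarrow> 'v \<Rightarrow> bool" where
  "walk \<Gamma> u [] w \<longleftrightarrow> u = w"
| "walk \<Gamma> u (d # ds) w \<longleftrightarrow> step_src \<Gamma> d = u \<and> walk \<Gamma> (step_tgt \<Gamma> d) ds w"

lemma walk_append:
  "walk \<Gamma> u (xs @ ys) w \<longleftrightarrow> (\<exists>v. walk \<Gamma> u xs v \<and> walk \<Gamma> v ys w)"
  by (induction xs arbitrary: u) auto

text \<open>
  Links the recursive description of walks, suited to induction, to the cyclic index condition by
  which oriented loops are defined.
\<close>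

lemma walk_iff_nth:
  assumes "ds \<noteq> []"
  shows "walk \<Gamma> u ds w \<longleftrightarrow>
    step_src \<Gamma> (ds ! 0) = u \<and>
    (\<forall>i. Suc i < length ds \<longrightarrow> step_tgt \<Gamma> (ds ! i) = step_src \<Gamma> (ds ! Suc i)) \<and>
    step_tgt \<Gamma> (last ds) = w"
  using assms
proof (induction ds arbitrary: u)
  case (Cons d ds)
  show ?case
  proof (cases "ds = []")
    case False
    have "(\<forall>i. Suc i < length (d # ds) \<longrightarrow>
             step_tgt \<Gamma> ((d # ds) ! i) = step_src \<Gamma> ((d # ds) ! Suc i)) \<longleftrightarrow>
          step_tgt \<Gamma> d = step_src \<Gamma> (ds ! 0) \<and>
          (\<forall>i. Suc i < length ds \<longrightarrow> step_tgt \<Gamma> (ds ! i) = step_src \<Gamma> (ds ! Suc i))"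
      (is "(\<forall>i. ?P i) \<longleftrightarrow> ?Q \<and> (\<forall>i. ?R i)")
    proof -
      have "(\<forall>i. ?P i) \<longleftrightarrow> ?P 0 \<and> (\<forall>i. ?P (Suc i))"
        using not0_implies_Suc by metis
      then show ?thesis using False by simp
    qed
    then show ?thesis using Cons.IH[OF False] False by auto
  qed auto
qed simp

lemma oriented_loop_iff_closed_walk:
  "oriented_loop \<Gamma> ds \<longleftrightarrow>
     ds \<noteq> [] \<and> fst ` set ds \<subseteq> arcs \<Gamma> \<and> distinct (map fst ds) \<and> (\<exists>u. walk \<Gamma> u ds u)"
proof (cases "ds = []")
  case False
  have "(\<forall>i<length ds. step_tgt \<Gamma> (ds ! i) = step_src \<Gamma> (ds ! ((i + 1) mod length ds))) \<longleftrightarrow>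
        (\<forall>i. Suc i < length ds \<longrightarrow> step_tgt \<Gamma> (ds ! i) = step_src \<Gamma> (ds ! Suc i)) \<and>
        step_tgt \<Gamma> (last ds) = step_src \<Gamma> (ds ! 0)" (is "?L \<longleftrightarrow> ?R1 \<and> ?R2")
  proof (intro iffI conjI)
    assume L: ?L
    show ?R1
    proof (intro allI impI)
      fix i assume "Suc i < length ds"
      then show "step_tgt \<Gamma> (ds ! i) = step_src \<Gamma> (ds ! Suc i)"
        using L[rule_format, of i] by simp
    qed
    show ?R2
      using L[rule_format, of "length ds - 1"] False by (simp add: last_conv_nth)
  next
    assume R: "?R1 \<and> ?R2"
    show ?L
    proof (intro allI impI)
      fix i assume i: "i < length ds"
      show "step_tgt \<Gamma> (ds ! i) = step_src \<Gamma> (ds ! ((i + 1) mod length ds))"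
      proof (cases "Suc i < length ds")
        case False
        with i have "Suc i = length ds" by simp
        then show ?thesis using R \<open>ds \<noteq> []\<close> by (auto simp: last_conv_nth dest: sym)
      qed (use R in simp)
    qed
  qed
  then show ?thesis
    using False by (auto simp: oriented_loop_def walk_iff_nth)
qed (simp add: oriented_loop_def)

lemma walk_update_arcs [simp]: "walk (\<Gamma>\<lparr>arcs := T\<rparr>) = walk \<Gamma>"
proof (intro ext)
  fix u ds w show "walk (\<Gamma>\<lparr>arcs := T\<rparr>) u ds w = walk \<Gamma> u ds w"
    by (induction ds arbitrary: u) (auto simp: step_src_def step_tgt_def)
qed

text \<open>
  Reachability by walks without repeated edges, because only such walks close up to oriented loops.
\<close>

definition trail_reachable :: "('v, 'e) pre_digraph \<Rightarrow> 'e set \<Rightarrow> 'v \<Rightarrow> 'v set" where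
  "trail_reachable \<Gamma> T u =
     {w. \<exists>ds. walk \<Gamma> u ds w \<and> fst ` set ds \<subseteq> T \<and> distinct (map fst ds)}"

lemma trail_reachable_refl: "u \<in> trail_reachable \<Gamma> T u"
  unfolding trail_reachable_def by (auto intro!: exI[of _ "[]"])

text \<open>
  A step along an edge that the trail has already used leads back to an endpoint of that
  earlier step, so the trail can be truncated there instead of being extended.
\<close>

lemma trail_reachable_step:
  assumes "fst d \<in> T" and "step_src \<Gamma> d \<in> trail_reachable \<Gamma> T u"
  shows "step_tgt \<Gamma> d \<in> trail_reachable \<Gamma> T u"
proof -
  obtain ds where ds: "walk \<Gamma> u ds (step_src \<Gamma> d)" "fst ` set ds \<subseteq> T" "distinct (map fst ds)"
    using assms(2) by (auto simp: trail_reachable_def)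
  show ?thesis
  proof (cases "fst d \<in> fst ` set ds")
    case False
    then have "walk \<Gamma> u (ds @ [d]) (step_tgt \<Gamma> d)" "fst ` set (ds @ [d]) \<subseteq> T"
      "distinct (map fst (ds @ [d]))"
      using ds assms(1) by (simp_all add: walk_append)
    then show ?thesis unfolding trail_reachable_def by blast
  next
    case True
    then obtain d' where d': "d' \<in> set ds" "fst d' = fst d" by force
    then obtain xs ys where xs: "ds = xs @ d' # ys" by (meson split_list)
    have "step_tgt \<Gamma> d = step_tgt \<Gamma> d' \<or> step_tgt \<Gamma> d = step_src \<Gamma> d'"
      using d'(2) by (auto simp: step_src_def step_tgt_def)
    moreover have "walk \<Gamma> u (xs @ [d']) (step_tgt \<Gamma> d')" "fst ` set (xs @ [d']) \<subseteq> T"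
      "distinct (map fst (xs @ [d']))" "walk \<Gamma> u xs (step_src \<Gamma> d')" "fst ` set xs \<subseteq> T"
      "distinct (map fst xs)"
      using ds unfolding xs by (auto simp: walk_append image_Un simp del: image_subset_iff)
    then have "step_tgt \<Gamma> d' \<in> trail_reachable \<Gamma> T u" "step_src \<Gamma> d' \<in> trail_reachable \<Gamma> T u"
      unfolding trail_reachable_def by blast+
    ultimately show ?thesis by auto
  qed
qed

lemma trail_reachable_closed:
  assumes "e \<in> T"
  shows "head \<Gamma> e \<in> trail_reachable \<Gamma> T u \<longleftrightarrow> tail \<Gamma> e \<in> trail_reachable \<Gamma> T u"
  using trail_reachable_step[of "(e, True)" T \<Gamma> u] trail_reachable_step[of "(e, False)" T \<Gamma> u] assms
  by (auto simp: step_src_def step_tgt_def)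

lemma trail_reachable_subset_verts:
  assumes "wf_digraph \<Gamma>" "T \<subseteq> arcs \<Gamma>" "u \<in> verts \<Gamma>"
  shows "trail_reachable \<Gamma> T u \<subseteq> verts \<Gamma>"
proof -
  have "w \<in> verts \<Gamma>" if "walk \<Gamma> u ds w" "fst ` set ds \<subseteq> T" "u \<in> verts \<Gamma>" for ds w u
    using that
  proof (induction ds arbitrary: u)
    case (Cons d ds)
    have "fst d \<in> arcs \<Gamma>" using Cons.prems(2) assms(2) by auto
    then have "step_tgt \<Gamma> d \<in> verts \<Gamma>"
      using assms(1) by (simp add: step_tgt_def wf_digraph_def)
    then show ?case using Cons by auto
  qed simp
  then show ?thesis using assms(3) unfolding trail_reachable_def by blast
qed

text \<open>
  Connectedness is used only through cuts: a vertex set that no edge leaves is empty or everything.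
  This avoids reachability in the symmetrized graph.
\<close>

lemma connected_iff_no_empty_cut:
  assumes "wf_digraph \<Gamma>"
  shows "Digraph_Component.connected \<Gamma> \<longleftrightarrow> verts \<Gamma> \<noteq> {} \<and>
    (\<forall>A\<subseteq>verts \<Gamma>. A \<noteq> {} \<longrightarrow>
      (\<forall>e\<in>arcs \<Gamma>. head \<Gamma> e \<in> A \<longleftrightarrow> tail \<Gamma> e \<in> A) \<longrightarrow> A = verts \<Gamma>)"
    (is "?C \<longleftrightarrow> ?N \<and> ?A")
proof -
  interpret S: pair_wf_digraph "mk_symmetric \<Gamma>"
    using assms by (rule wf_digraph.wellformed_mk_symmetric)
  have C: "?C \<longleftrightarrow> ?N \<and> (\<forall>u\<in>verts \<Gamma>. \<forall>v\<in>verts \<Gamma>. u \<rightarrow>\<^sup>*\<^bsub>mk_symmetric \<Gamma>\<^esub> v)"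
    by (simp add: Digraph_Component.connected_def strongly_connected_def)
  show ?thesis
  proof (intro iffI conjI)
    assume ?C
    then show ?N using C by blast
    show ?A
    proof (intro allI impI)
      fix A assume A: "A \<subseteq> verts \<Gamma>" "A \<noteq> {}"
        and cl: "\<forall>e\<in>arcs \<Gamma>. head \<Gamma> e \<in> A \<longleftrightarrow> tail \<Gamma> e \<in> A"
      from A obtain u where u: "u \<in> A" by blast
      have "v \<in> A" if "v \<in> verts \<Gamma>" for v
      proof -
        have "u \<in> verts \<Gamma>" using u A(1) by (rule rev_subsetD)
        then have "u \<rightarrow>\<^sup>*\<^bsub>mk_symmetric \<Gamma>\<^esub> v" using \<open>?C\<close>[unfolded C] that by simp
        then show ?thesis
        proof (induction rule: S.reachable_induct)
          case (step x y)
          then show ?case using cl by (auto simp: parcs_mk_symmetric)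
        qed (rule u)
      qed
      then show "A = verts \<Gamma>" using A by blast
    qed
  next
    assume R: "?N \<and> ?A"
    have "u \<rightarrow>\<^sup>*\<^bsub>mk_symmetric \<Gamma>\<^esub> v" if uv: "u \<in> verts \<Gamma>" "v \<in> verts \<Gamma>" for u v
    proof -
      let ?A = "{w. u \<rightarrow>\<^sup>*\<^bsub>mk_symmetric \<Gamma>\<^esub> w}"
      have "?A \<subseteq> verts \<Gamma>" using S.reachable_in_verts(2) by auto
      moreover have "u \<in> ?A" using uv by simp
      moreover have "head \<Gamma> e \<in> ?A \<longleftrightarrow> tail \<Gamma> e \<in> ?A" if "e \<in> arcs \<Gamma>" for e
      proof -
        have "(tail \<Gamma> e, head \<Gamma> e) \<in> arcs_ends (mk_symmetric \<Gamma>)"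
             "(head \<Gamma> e, tail \<Gamma> e) \<in> arcs_ends (mk_symmetric \<Gamma>)"
          using that by (auto simp: parcs_mk_symmetric)
        then show ?thesis
          using S.reachable_adj_trans[of u "tail \<Gamma> e" "head \<Gamma> e"]
            S.reachable_adj_trans[of u "head \<Gamma> e" "tail \<Gamma> e"] by auto
      qed
      ultimately have "?A = verts \<Gamma>" using R by blast
      then show ?thesis using uv by blast
    qed
    then show ?C unfolding C using R by simp
  qed
qed

lemma wf_digraph_update_arcs:
  assumes "wf_digraph \<Gamma>" "T \<subseteq> arcs \<Gamma>"
  shows "wf_digraph (\<Gamma>\<lparr>arcs := T\<rparr>)"
  using assms by (auto simp: wf_digraph_def)

lemma trail_between:
  assumes "wf_digraph \<Gamma>" "T \<subseteq> arcs \<Gamma>" "Digraph_Component.connected (\<Gamma>\<lparr>arcs := T\<rparr>)"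
    and "u \<in> verts \<Gamma>" "w \<in> verts \<Gamma>"
  obtains ds where "walk \<Gamma> u ds w" "fst ` set ds \<subseteq> T" "distinct (map fst ds)"
proof -
  let ?R = "trail_reachable \<Gamma> T u"
  have "?R \<subseteq> verts \<Gamma>" "?R \<noteq> {}"
    using trail_reachable_subset_verts[OF assms(1,2,4)] trail_reachable_refl[of u \<Gamma> T] by auto
  moreover have "\<forall>e\<in>T. head \<Gamma> e \<in> ?R \<longleftrightarrow> tail \<Gamma> e \<in> ?R"
    by (simp add: trail_reachable_closed)
  ultimately have "?R = verts \<Gamma>"
    using assms(3) connected_iff_no_empty_cut[OF wf_digraph_update_arcs[OF assms(1,2)]] by simp
  then show ?thesis using that assms(5) by (auto simp: trail_reachable_def)
qed

section \<open>Cycles, spanning trees and cuts\<close>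

lemma loop_chain_Cons:
  assumes "fst d \<notin> fst ` set ds"
  shows "loop_chain (d # ds) = loop_chain ds + axis (fst d) (if snd d then 1 else - 1)"
proof -
  have "(fst d, b) \<notin> set ds" for b using assms by (metis fst_conv imageI)
  then show ?thesis
    by (cases d) (auto simp: loop_chain_def axis_def vec_eq_iff)
qed

text \<open>
  The boundary telescopes along a walk. Distinctness of the edges matters because
  \<open>loop_chain\<close> records only whether an edge occurs, not how often.
\<close>

lemma boundary_loop_chain_walk:
  fixes \<Gamma> :: "('v, 'e::finite) pre_digraph"
  assumes "arcs \<Gamma> = UNIV" "walk \<Gamma> u ds w" "distinct (map fst ds)"
  shows "boundary \<Gamma> (loop_chain ds) v = of_bool (w = v) - of_bool (u = v)"
  using assms(2,3)
proof (induction ds arbitrary: u)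
  case Nil
  then show ?case by (simp add: boundary_def loop_chain_def)
next
  case (Cons d ds)
  let ?s = "if snd d then 1 else - 1 :: int"
  let ?b = "\<lambda>e. of_bool (head \<Gamma> e = v) - of_bool (tail \<Gamma> e = v) :: int"
  have "boundary \<Gamma> (loop_chain (d # ds)) v
      = boundary \<Gamma> (loop_chain ds) v + (\<Sum>e\<in>UNIV. axis (fst d) ?s $ e * ?b e)"
    using Cons.prems(2)
    by (simp add: loop_chain_Cons boundary_def assms(1) distrib_right sum.distrib)
  also have "(\<Sum>e\<in>UNIV. axis (fst d) ?s $ e * ?b e) = ?s * ?b (fst d)"
    by (subst sum.remove[of _ "fst d"]) (auto simp: axis_def intro!: sum.neutral)
  also have "\<dots> = of_bool (step_tgt \<Gamma> d = v) - of_bool (step_src \<Gamma> d = v)"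
    by (simp add: step_tgt_def step_src_def)
  finally show ?case using Cons by auto
qed

lemma loop_chain_in_H1:
  fixes \<Gamma> :: "('v, 'e::finite) pre_digraph"
  assumes "arcs \<Gamma> = UNIV" "oriented_loop \<Gamma> ds"
  shows "loop_chain ds \<in> H1 \<Gamma>"
  using assms by (auto simp: oriented_loop_iff_closed_walk H1_def boundary_loop_chain_walk)

lemma walk_closed_by_edge:
  assumes "walk \<Gamma> (head \<Gamma> e) ds (tail \<Gamma> e)" "fst ` set ds \<subseteq> T" "distinct (map fst ds)" "e \<notin> T"
  shows "oriented_loop (\<Gamma>\<lparr>arcs := insert e T\<rparr>) ((e, True) # ds)"
  using assms by (auto simp: oriented_loop_iff_closed_walk step_src_def step_tgt_def)

text \<open>
  The edge \<open>e\<close> followed by a trail in \<open>T\<close> from its head back to its tail.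
\<close>

lemma fundamental_cycle:
  fixes \<Gamma> :: "('v, 'e::finite) pre_digraph"
  assumes "wf_digraph \<Gamma>" "arcs \<Gamma> = UNIV" "Digraph_Component.connected (\<Gamma>\<lparr>arcs := T\<rparr>)" "e \<notin> T"
  obtains c where "c \<in> H1 \<Gamma>" "c $ e = 1" "\<And>e'. e' \<notin> T \<Longrightarrow> e' \<noteq> e \<Longrightarrow> c $ e' = 0"
proof -
  have v: "head \<Gamma> e \<in> verts \<Gamma>" "tail \<Gamma> e \<in> verts \<Gamma>"
    using assms(1,2) by (auto simp: wf_digraph_def)
  have "T \<subseteq> arcs \<Gamma>" using assms(2) by simp
  from trail_between[OF assms(1) this assms(3) v] obtain ds where ds: "walk \<Gamma> (head \<Gamma> e) ds (tail \<Gamma> e)" "fst ` set ds \<subseteq> T" "distinct (map fst ds)" .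
  let ?c = "loop_chain ((e, True) # ds)"
  have "oriented_loop (\<Gamma>\<lparr>arcs := insert e T\<rparr>) ((e, True) # ds)"
    using ds assms(4) by (rule walk_closed_by_edge)
  then have "?c \<in> H1 \<Gamma>"
    by (intro loop_chain_in_H1[OF assms(2)]) (simp add: oriented_loop_iff_closed_walk assms(2))
  moreover have "?c $ e = 1" by (simp add: loop_chain_def)
  moreover have "?c $ e' = 0" if "e' \<notin> T" "e' \<noteq> e" for e'
    using that ds(2) by (force simp: loop_chain_def)
  ultimately show ?thesis using that by blast
qed

text \<open>
  The coboundary of the indicator function of \<open>A\<close>: it vanishes exactly on the edges that do not
  cross the cut between \<open>A\<close> and its complement. It is needed with integer and with real values.
\<close>

definition cut_sign :: "('v, 'e) pre_digraph \<Rightarrow> 'v set \<Rightarrow> 'e \<Rightarrow> 'a::ring_1" where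
  "cut_sign \<Gamma> A e = of_bool (head \<Gamma> e \<in> A) - of_bool (tail \<Gamma> e \<in> A)"

lemma of_int_cut_sign: "of_int (cut_sign \<Gamma> A e) = cut_sign \<Gamma> A e"
  by (simp add: cut_sign_def)

lemma cut_sign_eq_0_iff:
  "cut_sign \<Gamma> A e = (0::'a::ring_1) \<longleftrightarrow> (head \<Gamma> e \<in> A \<longleftrightarrow> tail \<Gamma> e \<in> A)"
  by (auto simp: cut_sign_def)

text \<open>
  Summing the boundary over the vertices of \<open>A\<close>, an edge inside \<open>A\<close> cancels, so only the edges of
  the cut remain: a cycle crosses each cut as often in one direction as in the other.
\<close>

lemma H1_cut_relation:
  fixes \<Gamma> :: "('v, 'e::finite) pre_digraph"
  assumes "finite (verts \<Gamma>)" "arcs \<Gamma> = UNIV" "c \<in> H1 \<Gamma>" "A \<subseteq> verts \<Gamma>"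
  shows "(\<Sum>e\<in>UNIV. c $ e * cut_sign \<Gamma> A e) = 0"
proof -
  have A: "finite A" using assms finite_subset by blast
  have "cut_sign \<Gamma> A e = (\<Sum>v\<in>A. of_bool (head \<Gamma> e = v) - of_bool (tail \<Gamma> e = v) :: int)" for e
    using A by (simp add: cut_sign_def sum_subtractf of_bool_def)
  then have "(\<Sum>e\<in>UNIV. c $ e * cut_sign \<Gamma> A e)
      = (\<Sum>e\<in>UNIV. \<Sum>v\<in>A. c $ e * (of_bool (head \<Gamma> e = v) - of_bool (tail \<Gamma> e = v)))"
    by (simp add: sum_distrib_left)
  also have "\<dots> = (\<Sum>v\<in>A. boundary \<Gamma> c v)"
    unfolding boundary_def assms(2) by (rule sum.swap)
  also have "\<dots> = 0"
    using assms(3,4) by (auto simp: H1_def intro!: sum.neutral)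
  finally show ?thesis .
qed

text \<open>
  In a loop-free edge set \<open>T\<close> every edge is a bridge: the vertices reachable from the head of
  \<open>e\<close> without using \<open>e\<close> do not include its tail, so \<open>e\<close> is the only edge of \<open>T\<close> crossing the
  corresponding cut, and the cut relation leaves nothing but the coefficient at \<open>e\<close>.
\<close>

lemma acyclic_imp_no_cycle:
  fixes \<Gamma> :: "('v, 'e::finite) pre_digraph"
  assumes "fin_digraph \<Gamma>" "arcs \<Gamma> = UNIV" "\<nexists>ds. oriented_loop (\<Gamma>\<lparr>arcs := T\<rparr>) ds"
    and "c \<in> H1 \<Gamma>" and supp: "\<And>e. e \<notin> T \<Longrightarrow> c $ e = 0"
  shows "c = 0"
proof -
  have wf: "wf_digraph \<Gamma>" and fin: "finite (verts \<Gamma>)"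
    using assms(1) by (simp_all add: fin_digraph_def fin_digraph_axioms_def)
  have "c $ e = 0" if e: "e \<in> T" for e
  proof -
    let ?A = "trail_reachable \<Gamma> (T - {e}) (head \<Gamma> e)"
    have "head \<Gamma> e \<in> verts \<Gamma>" using wf assms(2) by (auto simp: wf_digraph_def)
    then have "?A \<subseteq> verts \<Gamma>"
      using assms(2) by (intro trail_reachable_subset_verts[OF wf]) auto
    note H1_cut_relation[OF fin assms(2,4) this]
    moreover have "tail \<Gamma> e \<notin> ?A"
    proof
      assume "tail \<Gamma> e \<in> ?A"
      then obtain ds where "walk \<Gamma> (head \<Gamma> e) ds (tail \<Gamma> e)" "fst ` set ds \<subseteq> T - {e}" "distinct (map fst ds)"
        by (auto simp: trail_reachable_def)
      from walk_closed_by_edge[OF this] have "oriented_loop (\<Gamma>\<lparr>arcs := insert e (T - {e})\<rparr>) ((e, True) # ds)"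
        by simp
      then show False using assms(3) e by (auto simp: insert_absorb)
    qed
    moreover have "head \<Gamma> e \<in> ?A" by (rule trail_reachable_refl)
    moreover have "c $ e' * cut_sign \<Gamma> ?A e' = 0" if "e' \<noteq> e" for e'
      using supp[of e'] trail_reachable_closed[of e' "T - {e}" \<Gamma> "head \<Gamma> e"] that
      by (cases "e' \<in> T") (auto simp: cut_sign_eq_0_iff)
    ultimately show ?thesis
      by (subst (asm) sum.remove[of _ e]) (auto simp: cut_sign_def sum.neutral)
  qed
  then show ?thesis using supp by (auto simp: vec_eq_iff)
qed


lemma H1_add: "c \<in> H1 \<Gamma> \<Longrightarrow> c' \<in> H1 \<Gamma> \<Longrightarrow> c + c' \<in> H1 \<Gamma>"
  by (simp add: H1_def boundary_def distrib_right sum.distrib)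

lemma H1_scale: "c \<in> H1 \<Gamma> \<Longrightarrow> z *s c \<in> H1 \<Gamma>"
  by (simp add: H1_def boundary_def mult.assoc sum_distrib_left[symmetric])

lemma H1_sum: "(\<And>i. i \<in> I \<Longrightarrow> c i \<in> H1 \<Gamma>) \<Longrightarrow> (\<Sum>i\<in>I. c i) \<in> H1 \<Gamma>"
proof (induction I rule: infinite_finite_induct)
  case (insert i I)
  then show ?case by (simp add: H1_add)
qed (simp_all add: H1_def boundary_def)

lemma H1_diff:
  assumes "c \<in> H1 \<Gamma>" "c' \<in> H1 \<Gamma>"
  shows "c - c' \<in> H1 \<Gamma>"
  using H1_add[OF assms(1) H1_scale[OF assms(2), of "- 1"]] by (simp add: vector_smult_lneg)

section \<open>The Cauchy--Binet formula\<close>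

text \<open>
  The square submatrix with rows in \<open>S\<close>. A square matrix needs equal index types, so the rows are
  enumerated by an arbitrary bijection; reordering the rows only changes the sign of the
  determinant, which enters squared.
\<close>

definition rows_of :: "'a ^ 'l ^ 'e \<Rightarrow> 'e::finite set \<Rightarrow> 'a ^ 'l ^ 'l::finite" where
  "rows_of A S = (\<chi> k. A $ ((SOME b. bij_betw b UNIV S) k))"

lemma rows_of_eq:
  fixes A :: "'a ^ 'l ^ 'e::finite"
  assumes "card S = CARD('l::finite)"
  obtains b where "bij_betw b (UNIV :: 'l set) S" "rows_of A S = (\<chi> k. A $ b k)"
proof -
  have "\<exists>b. bij_betw b (UNIV :: 'l set) S"
    using assms by (intro finite_same_card_bij) auto
  then have "bij_betw (SOME b. bij_betw b (UNIV :: 'l set) S) UNIV S" by (rule someI_ex)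
  then show ?thesis using that by (simp add: rows_of_def)
qed

text \<open>
  The contribution of one row set \<open>S\<close> to the Cauchy--Binet expansion. The injections with image
  \<open>S\<close> differ from a fixed enumeration by permutations \<open>\<pi>\<close>. Each determinant contributes the factor
  \<open>sign \<pi>\<close>, and summing the remaining products with these signs gives the determinant of the
  transposed submatrix, hence a second copy of \<open>det (rows_of A S)\<close>.
\<close>

lemma sum_injections_onto:
  fixes A :: "'a::comm_ring_1 ^ 'l ^ 'e::finite" and t :: "'a ^ 'e"
  assumes "card S = CARD('l::finite)"
  shows "(\<Sum>f | inj f \<and> range f = S. (\<Prod>k\<in>UNIV. t $ f k * A $ f k $ k) * det (\<chi> k. A $ f k))
    = (\<Prod>e\<in>S. t $ e) * (det (rows_of A S))\<^sup>2"
proof -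
  obtain b where b: "bij_betw b (UNIV :: 'l set) S" and M: "rows_of A S = (\<chi> k. A $ b k)"
    using rows_of_eq[OF assms] .
  let ?M = "rows_of A S"
  have "bij_betw (\<lambda>\<pi>. b \<circ> \<pi>) {\<pi>. \<pi> permutes UNIV} {f. inj f \<and> range f = S}"
  proof (rule bij_betwI[where g = "\<lambda>f. inv_into UNIV b \<circ> f"])
    show "(\<lambda>\<pi>. b \<circ> \<pi>) \<in> {\<pi>. \<pi> permutes UNIV} \<rightarrow> {f. inj f \<and> range f = S}"
    proof safe
      fix \<pi> :: "'l \<Rightarrow> 'l" assume "\<pi> permutes UNIV"
      then have "bij_betw (b \<circ> \<pi>) UNIV S"
        using b bij_betw_trans permutes_imp_bij by blast
      then show "inj (b \<circ> \<pi>)" "\<And>x. (b \<circ> \<pi>) x \<in> S" "\<And>x. x \<in> S \<Longrightarrow> x \<in> range (b \<circ> \<pi>)"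
        by (auto simp: bij_betw_def)
    qed
    show "(\<lambda>f. inv_into UNIV b \<circ> f) \<in> {f. inj f \<and> range f = S} \<rightarrow> {\<pi>. \<pi> permutes UNIV}"
    proof safe
      fix f :: "'l \<Rightarrow> 'e" assume "inj f" "S = range f"
      then have "bij_betw f UNIV S" by (simp add: bij_betw_def)
      then have "bij (inv_into UNIV b \<circ> f)"
        using bij_betw_trans bij_betw_inv_into[OF b] by blast
      then show "(inv_into UNIV b \<circ> f) permutes UNIV"
        by (intro bij_imp_permutes) auto
    qed
  next
    fix \<pi> :: "'l \<Rightarrow> 'l"
    show "inv_into UNIV b \<circ> (b \<circ> \<pi>) = \<pi>"
      using b by (auto simp: bij_betw_def fun_eq_iff)
  next
    fix f assume "f \<in> {f. inj f \<and> range f = S}"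
    then show "b \<circ> (inv_into UNIV b \<circ> f) = f"
      using b by (auto simp: bij_betw_def fun_eq_iff f_inv_into_f)
  qed
  from sum.reindex_bij_betw[OF this,
      of "\<lambda>f. (\<Prod>k\<in>UNIV. t $ f k * A $ f k $ k) * det (\<chi> k. A $ f k)"]
  have "(\<Sum>f | inj f \<and> range f = S. (\<Prod>k\<in>UNIV. t $ f k * A $ f k $ k) * det (\<chi> k. A $ f k))
    = (\<Sum>\<pi> | \<pi> permutes UNIV.
        (\<Prod>k\<in>UNIV. t $ b (\<pi> k) * A $ b (\<pi> k) $ k) * det (\<chi> k. A $ b (\<pi> k)))"
    by simp
  also have "\<dots> = (\<Sum>\<pi> | \<pi> permutes (UNIV :: 'l set).
        (\<Prod>e\<in>S. t $ e) * det ?M * (of_int (sign \<pi>) * (\<Prod>k\<in>UNIV. transpose ?M $ k $ \<pi> k)))"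
  proof (intro sum.cong refl)
    fix \<pi> assume "\<pi> \<in> {\<pi>. \<pi> permutes (UNIV :: 'l set)}"
    then have \<pi>: "\<pi> permutes UNIV" by simp
    have "bij_betw (b \<circ> \<pi>) UNIV S" using \<pi> b bij_betw_trans permutes_imp_bij by blast
    then have "(\<Prod>k\<in>UNIV. t $ b (\<pi> k)) = (\<Prod>e\<in>S. t $ e)"
      using prod.reindex_bij_betw[of "b \<circ> \<pi>" UNIV S "($) t"] by simp
    moreover have "det (\<chi> k. A $ b (\<pi> k)) = of_int (sign \<pi>) * det ?M"
      using det_permute_rows[OF \<pi>, of ?M] by (simp add: M)
    ultimately show "(\<Prod>k\<in>UNIV. t $ b (\<pi> k) * A $ b (\<pi> k) $ k) * det (\<chi> k. A $ b (\<pi> k))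
        = (\<Prod>e\<in>S. t $ e) * det ?M * (of_int (sign \<pi>) * (\<Prod>k\<in>UNIV. transpose ?M $ k $ \<pi> k))"
      by (simp add: prod.distrib M transpose_def mult_ac)
  qed
  also have "\<dots> = (\<Prod>e\<in>S. t $ e) * det ?M * det (transpose ?M)"
    unfolding det_def[of "transpose ?M"] by (rule sum_distrib_left[symmetric])
  finally show ?thesis by (simp add: power2_eq_square mult.assoc)
qed

text \<open>
  Multilinearity of the determinant for sums over an index type unrelated to the size of the matrix.
\<close>

lemma det_rows_sum:
  fixes a :: "'l::finite \<Rightarrow> 'e \<Rightarrow> 'a::comm_ring_1 ^ 'l"
  assumes "finite E"
  shows "det (\<chi> k. \<Sum>e\<in>E. a k e) = (\<Sum>f\<in>UNIV \<rightarrow>\<^sub>E E. det (\<chi> k. a k (f k)))"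
proof -
  have "det (\<chi> k. \<Sum>e\<in>E. a k e)
      = (\<Sum>\<pi> | \<pi> permutes UNIV. \<Sum>f\<in>UNIV \<rightarrow>\<^sub>E E. of_int (sign \<pi>) * (\<Prod>k\<in>UNIV. a k (f k) $ \<pi> k))"
    using assms by (simp add: det_def prod_sum_PiE sum_distrib_left)
  also have "\<dots> = (\<Sum>f\<in>UNIV \<rightarrow>\<^sub>E E. det (\<chi> k. a k (f k)))"
    by (subst sum.swap) (simp add: det_def)
  finally show ?thesis .
qed

text \<open>
  The Cauchy--Binet formula for a Gram matrix with weights. Row \<open>k\<close> of the product is the
  combination of the rows of \<open>A\<close> with weights \<open>t\<^sub>e A\<^sub>e\<^sub>k\<close>. Expanding by multilinearity gives one term
  for each choice of a row per index; a choice with a repetition has two equal rows, and the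
  injective choices are grouped by their image.
\<close>

theorem det_weighted_gram:
  fixes A :: "'a::comm_ring_1 ^ 'l::finite ^ 'e::finite" and t :: "'a ^ 'e"
  shows "det (transpose A ** (\<chi> i j. if i = j then t $ i else 0) ** A)
    = (\<Sum>S | card S = CARD('l). (\<Prod>e\<in>S. t $ e) * (det (rows_of A S))\<^sup>2)"
proof -
  let ?g = "\<lambda>f. (\<Prod>k\<in>UNIV. t $ f k * A $ f k $ k) * det (\<chi> k. A $ f k)"
  have rows: "transpose A ** (\<chi> i j. if i = j then t $ i else 0) ** A
      = (\<chi> k. \<Sum>e\<in>UNIV. (t $ e * A $ e $ k) *s A $ e)"
    by (simp add: vec_eq_iff matrix_matrix_mult_def transpose_def if_distrib mult_ac cong: if_cong)
  have "det (transpose A ** (\<chi> i j. if i = j then t $ i else 0) ** A)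
      = (\<Sum>f\<in>UNIV. det (\<chi> k. (t $ f k * A $ f k $ k) *s A $ f k))"
    unfolding rows by (subst det_rows_sum) (simp_all add: PiE_UNIV_domain)
  also have "\<dots> = (\<Sum>f\<in>UNIV. ?g f)"
    by (simp add: det_rows_mul)
  also have "\<dots> = (\<Sum>f | inj f. ?g f)"
  proof (rule sum.mono_neutral_right)
    show "\<forall>f\<in>UNIV - {f. inj f}. ?g f = 0"
    proof
      fix f :: "'l \<Rightarrow> 'e" assume "f \<in> UNIV - {f. inj f}"
      then obtain i j where "i \<noteq> j" "f i = f j" by (auto simp: inj_def)
      then have "det (\<chi> k. A $ f k) = 0"
        by (intro det_identical_rows[of i j]) (auto simp: row_def)
      then show "?g f = 0" by simp
    qed
  qed auto
  also have "\<dots> = (\<Sum>S | card S = CARD('l). \<Sum>f | inj f \<and> range f = S. ?g f)"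
    using sum.group[of "{f :: 'l \<Rightarrow> 'e. inj f}" "{S. card S = CARD('l)}" range ?g]
    by (simp add: card_image image_subset_iff)
  finally show ?thesis by (simp add: sum_injections_onto)
qed

section \<open>Minors of the loop matrix and Kirchhoff's identity\<close>

lemma det_of_int: "det (\<chi> i j. of_int (M $ i $ j)) = of_int (det (M :: int ^ 'l ^ 'l::finite))"
  by (simp add: det_def)

lemma eta_mult_int_vector:
  "(eta L *v (\<chi> k. of_int (a k))) $ e = of_int ((\<Sum>k\<in>UNIV. a k *s loop_chain (L k)) $ e)"
  by (simp add: eta_def matrix_vector_mult_def mult.commute)

lemma eta_cut_relation:
  fixes \<Gamma> :: "('v, 'e::finite) pre_digraph" and L :: "'l::finite \<Rightarrow> ('e \<times> bool) list"
  assumes "finite (verts \<Gamma>)" "arcs \<Gamma> = UNIV" "\<And>k. oriented_loop \<Gamma> (L k)" "A \<subseteq> verts \<Gamma>"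
  shows "(\<Sum>e\<in>UNIV. eta L $ e $ k * cut_sign \<Gamma> A e) = 0"
proof -
  have "(\<Sum>e\<in>UNIV. loop_chain (L k) $ e * cut_sign \<Gamma> A e) = 0"
    using assms by (intro H1_cut_relation loop_chain_in_H1) auto
  then have "(of_int (\<Sum>e\<in>UNIV. loop_chain (L k) $ e * cut_sign \<Gamma> A e) :: real) = of_int 0"
    by (simp only:)
  then show ?thesis by (simp add: eta_def of_int_cut_sign)
qed

text \<open>
  Column \<open>e\<close> of \<open>F\<close> holds the coordinates of the fundamental cycle of \<open>e\<close> in the basis \<open>L\<close>. The
  first identity says that this cycle meets the complement of \<open>T\<close> only in \<open>e\<close>. For the
  second, subtracting from a loop its combination of fundamental cycles leaves a cycle inside the
  tree, which is zero; comparing coordinates with respect to the basis gives the claim.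
\<close>

lemma tree_complement_matrix_inverse:
  fixes \<Gamma> :: "('v, 'e::finite) pre_digraph" and L :: "'l::finite \<Rightarrow> ('e \<times> bool) list"
  assumes "fin_digraph \<Gamma>" "arcs \<Gamma> = UNIV" "loop_basis \<Gamma> L" "spanning_tree_edges \<Gamma> T"
  obtains F :: "'l \<Rightarrow> 'e \<Rightarrow> int"
  where "\<And>e e'. e \<notin> T \<Longrightarrow> e' \<notin> T \<Longrightarrow>
      (\<Sum>k\<in>UNIV. loop_chain (L k) $ e' * F k e) = of_bool (e' = e)"
    and "\<And>k k'. (\<Sum>e\<in>- T. F k' e * loop_chain (L k) $ e) = of_bool (k' = k)"
proof -
  have wf: "wf_digraph \<Gamma>" using assms(1) by (simp add: fin_digraph_def)
  have L: "loop_chain (L k) \<in> H1 \<Gamma>" for k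
    using assms(3) by (intro loop_chain_in_H1[OF assms(2)]) (simp add: loop_basis_def)
  have "\<exists>c. c \<in> H1 \<Gamma> \<and> c $ e = 1 \<and> (\<forall>e'. e' \<notin> T \<longrightarrow> e' \<noteq> e \<longrightarrow> c $ e' = 0)" if e: "e \<notin> T" for e
  proof -
    have "Digraph_Component.connected (\<Gamma>\<lparr>arcs := T\<rparr>)"
      using assms(4) by (simp add: spanning_tree_edges_def)
    then obtain c where "c \<in> H1 \<Gamma>" "c $ e = 1" "\<And>e'. e' \<notin> T \<Longrightarrow> e' \<noteq> e \<Longrightarrow> c $ e' = 0"
      by (rule fundamental_cycle[OF wf assms(2) _ e]) blast
    then show ?thesis by blast
  qed
  then obtain c where c: "\<And>e. e \<notin> T \<Longrightarrow> c e \<in> H1 \<Gamma>"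
    "\<And>e e'. e \<notin> T \<Longrightarrow> e' \<notin> T \<Longrightarrow> c e $ e' = of_bool (e' = e)"
    by (metis (full_types) of_bool_eq_0_iff of_bool_eq_1_iff)
  have "\<exists>a :: 'l \<Rightarrow> int. c e = (\<Sum>k\<in>UNIV. a k *s loop_chain (L k))" if "e \<notin> T" for e
    using assms(3) c(1)[OF that] unfolding loop_basis_def by (meson ex1_implies_ex)
  then obtain G :: "'e \<Rightarrow> 'l \<Rightarrow> int"
    where G: "\<And>e. e \<notin> T \<Longrightarrow> c e = (\<Sum>k\<in>UNIV. G e k *s loop_chain (L k))"
    by metis
  show ?thesis
  proof (rule that[of "\<lambda>k e. G e k"])
    fix e e' assume "e \<notin> T" "e' \<notin> T"
    then show "(\<Sum>k\<in>UNIV. loop_chain (L k) $ e' * G e k) = of_bool (e' = e)"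
      using c(2)[of e e'] G[of e] by (simp add: mult.commute)
  next
    fix k k'
    let ?l = "loop_chain (L k)"
    let ?s = "\<Sum>e\<in>- T. (?l $ e) *s c e"
    have "?l - ?s = 0"
    proof (rule acyclic_imp_no_cycle[OF assms(1,2)])
      show "\<nexists>ds. oriented_loop (\<Gamma>\<lparr>arcs := T\<rparr>) ds"
        using assms(4) by (simp add: spanning_tree_edges_def)
      show "?l - ?s \<in> H1 \<Gamma>"
        by (intro H1_diff H1_sum H1_scale L c(1)) simp
      show "(?l - ?s) $ e = 0" if "e \<notin> T" for e
      proof -
        have "?s $ e = (\<Sum>e'\<in>- T. if e' = e then ?l $ e' else 0)"
          using that by (auto simp: c(2) intro!: sum.cong)
        then show ?thesis using that by simp
      qed
    qed
    then have "?l = ?s" by simp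
    also have "?s = (\<Sum>e\<in>- T. \<Sum>k'\<in>UNIV. (?l $ e * G e k') *s loop_chain (L k'))"
      by (intro sum.cong refl) (simp add: G vec_eq_iff sum_distrib_left mult.assoc)
    also have "\<dots> = (\<Sum>k'\<in>UNIV. (\<Sum>e\<in>- T. G e k' * ?l $ e) *s loop_chain (L k'))"
      by (subst sum.swap) (simp add: vec_eq_iff sum_distrib_left mult_ac)
    finally have 1: "?l = (\<Sum>k'\<in>UNIV. (\<Sum>e\<in>- T. G e k' * ?l $ e) *s loop_chain (L k'))" .
    \<comment> \<open>The same loop expanded trivially as a basis element; coordinates are unique.\<close>
    have "(\<Sum>k'\<in>UNIV. of_bool (k' = k) *s loop_chain (L k'))
        = (\<Sum>k'\<in>UNIV. if k' = k then loop_chain (L k') else 0)"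
      by (intro sum.cong) auto
    then have 2: "?l = (\<Sum>k'\<in>UNIV. of_bool (k' = k) *s loop_chain (L k'))" by simp
    have "\<exists>!a :: 'l \<Rightarrow> int. ?l = (\<Sum>k'\<in>UNIV. a k' *s loop_chain (L k'))"
      using assms(3) L by (simp add: loop_basis_def)
    then obtain a\<^sub>0 :: "'l \<Rightarrow> int"
      where "\<And>a. ?l = (\<Sum>k'\<in>UNIV. a k' *s loop_chain (L k')) \<Longrightarrow> a = a\<^sub>0"
      by (elim ex1E) blast
    from this[OF 1] this[OF 2] have "(\<lambda>k'. \<Sum>e\<in>- T. G e k' * ?l $ e) = (\<lambda>k'. of_bool (k' = k))"
      by simp
    then show "(\<Sum>e\<in>- T. G e k' * ?l $ e) = of_bool (k' = k)"
      by (rule fun_cong)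
  qed
qed

text \<open>
  Matrices \<open>N\<close> and \<open>F\<close> with \<open>N F = 1\<close> and \<open>F N = 1\<close> are square, since the two products have the same
  trace.
\<close>

lemma card_complement_spanning_tree:
  fixes \<Gamma> :: "('v, 'e::finite) pre_digraph" and L :: "'l::finite \<Rightarrow> ('e \<times> bool) list"
  assumes "fin_digraph \<Gamma>" "arcs \<Gamma> = UNIV" "loop_basis \<Gamma> L" "spanning_tree_edges \<Gamma> T"
  shows "card (- T) = CARD('l)"
proof -
  obtain F :: "'l \<Rightarrow> 'e \<Rightarrow> int"
    where F1: "\<And>e e'. e \<notin> T \<Longrightarrow> e' \<notin> T \<Longrightarrow>
        (\<Sum>k\<in>UNIV. loop_chain (L k) $ e' * F k e) = of_bool (e' = e)"
      and F2: "\<And>k k'. (\<Sum>e\<in>- T. F k' e * loop_chain (L k) $ e) = of_bool (k' = k)"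
    by (rule tree_complement_matrix_inverse[OF assms]) blast
  have "int (card (- T)) = (\<Sum>e\<in>- T. \<Sum>k\<in>UNIV. loop_chain (L k) $ e * F k e)"
    by (simp add: F1)
  also have "\<dots> = (\<Sum>k\<in>UNIV. \<Sum>e\<in>- T. F k e * loop_chain (L k) $ e)"
    by (subst sum.swap) (simp add: mult.commute)
  also have "\<dots> = int (CARD('l))"
    by (simp add: F2)
  finally show ?thesis by simp
qed

lemma det_nonzero_imp_kernel_trivial:
  fixes M :: "real ^ 'l ^ 'l::finite"
  assumes "det M \<noteq> 0" "M *v x = 0"
  shows "x = 0"
  using assms by (metis invertible_det_nz invertible_left_inverse matrix_left_invertible_ker)

text \<open>
  For a tree the submatrix has an integer inverse, so its determinant is \<open>\<plusminus>1\<close>. Conversely,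
  a nonzero determinant excludes loops in the complement of \<open>S\<close>, since they would give kernel vectors, and
  empty cuts, since they would give linear relations between the rows.
\<close>

theorem det_rows_of_eta_squared:
  fixes \<Gamma> :: "('v, 'e::finite) pre_digraph" and L :: "'l::finite \<Rightarrow> ('e \<times> bool) list"
  assumes "fin_digraph \<Gamma>" "arcs \<Gamma> = UNIV" "Digraph_Component.connected \<Gamma>" "loop_basis \<Gamma> L"
    and "card S = CARD('l)"
  shows "(det (rows_of (eta L) S))\<^sup>2 = of_bool (spanning_tree_edges \<Gamma> (- S))"
proof -
  have wf: "wf_digraph \<Gamma>" and fin: "finite (verts \<Gamma>)"
    using assms(1) by (simp_all add: fin_digraph_def fin_digraph_axioms_def)
  have L: "oriented_loop \<Gamma> (L k)" for k using assms(4) by (simp add: loop_basis_def)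
  obtain b where b: "bij_betw b (UNIV :: 'l set) S" and M: "rows_of (eta L) S = (\<chi> k. eta L $ b k)"
    using rows_of_eq[OF assms(5)] .
  let ?M = "rows_of (eta L) S"
  have bS: "b i \<in> S" for i using b by (auto simp: bij_betw_def)
  have unit: "(det ?M)\<^sup>2 = 1" if tree: "spanning_tree_edges \<Gamma> (- S)"
  proof -
    obtain F :: "'l \<Rightarrow> 'e \<Rightarrow> int"
      where F: "\<And>e e'. e \<notin> - S \<Longrightarrow> e' \<notin> - S \<Longrightarrow>
        (\<Sum>k\<in>UNIV. loop_chain (L k) $ e' * F k e) = of_bool (e' = e)"
      by (rule tree_complement_matrix_inverse[OF assms(1,2,4) tree]) blast
    define N :: "int ^ 'l ^ 'l" where "N = (\<chi> i k. loop_chain (L k) $ b i)"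
    define K :: "int ^ 'l ^ 'l" where "K = (\<chi> k j. F k (b j))"
    have "N ** K = mat 1"
      using b bS by (auto simp: vec_eq_iff matrix_matrix_mult_def mat_def N_def K_def F bij_betw_def inj_eq)
    then have "det N * det K = 1"
      by (metis det_mul det_I)
    then have "(det N)\<^sup>2 = 1"
      by (metis power2_eq_1_iff zmult_eq_1_iff)
    moreover have "?M = (\<chi> i j. of_int (N $ i $ j))"
      unfolding M by (simp add: N_def eta_def vec_eq_iff)
    then have "det ?M = of_int (det N)" by (simp only: det_of_int)
    ultimately show ?thesis by (metis of_int_1 of_int_power)
  qed
  have "spanning_tree_edges \<Gamma> (- S)" if det: "det ?M \<noteq> 0"
    unfolding spanning_tree_edges_def
  proof (intro conjI notI)
    show "- S \<subseteq> arcs \<Gamma>" using assms(2) by simp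
  next
    have wfS: "wf_digraph (\<Gamma>\<lparr>arcs := - S\<rparr>)" using wf by (rule wf_digraph_update_arcs) (simp add: assms(2))
    \<comment> \<open>A cut avoiding \<open>- S\<close> makes its signs a left kernel vector, so it avoids \<open>S\<close> as well and is an empty cut of \<open>\<Gamma>\<close>.\<close>
    have "A = verts \<Gamma>" if A: "A \<subseteq> verts \<Gamma>" "A \<noteq> {}"
      and cl: "\<forall>e\<in>- S. head \<Gamma> e \<in> A \<longleftrightarrow> tail \<Gamma> e \<in> A" for A
    proof -
      have "transpose ?M *v (\<chi> i. cut_sign \<Gamma> A (b i)) = 0"
      proof -
        have "(\<Sum>i\<in>UNIV. eta L $ b i $ k * cut_sign \<Gamma> A (b i)) = 0" for k
        proof -
          have "(\<Sum>i\<in>UNIV. eta L $ b i $ k * cut_sign \<Gamma> A (b i))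
              = (\<Sum>e\<in>S. eta L $ e $ k * cut_sign \<Gamma> A e)"
            by (rule sum.reindex_bij_betw[OF b])
          also have "\<dots> = (\<Sum>e\<in>UNIV. eta L $ e $ k * cut_sign \<Gamma> A e)"
            using cl by (intro sum.mono_neutral_left) (auto simp: cut_sign_eq_0_iff)
          also have "\<dots> = 0" by (rule eta_cut_relation[OF fin assms(2) L A(1)])
          finally show ?thesis .
        qed
        then show ?thesis by (simp add: vec_eq_iff matrix_vector_mult_def transpose_def M)
      qed
      then have y: "(\<chi> i. (cut_sign \<Gamma> A (b i) :: real)) = 0"
        by (rule det_nonzero_imp_kernel_trivial[rotated]) (simp only: det_transpose, rule det)
      have "head \<Gamma> e \<in> A \<longleftrightarrow> tail \<Gamma> e \<in> A" for e
      proof (cases "e \<in> S")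
        case True
        then obtain i where "e = b i" using b by (auto simp: bij_betw_def)
        then have "cut_sign \<Gamma> A e = (0::real)" using y by (simp add: vec_eq_iff)
        then show ?thesis by (simp add: cut_sign_eq_0_iff)
      qed (use cl in simp)
      then show ?thesis
        using assms(3) A unfolding connected_iff_no_empty_cut[OF wf] by simp
    qed
    moreover have "verts \<Gamma> \<noteq> {}"
      using assms(3) unfolding connected_iff_no_empty_cut[OF wf] by simp
    ultimately show "Digraph_Component.connected (\<Gamma>\<lparr>arcs := - S\<rparr>)"
      unfolding connected_iff_no_empty_cut[OF wfS] by simp
  next
    assume "\<exists>ds. oriented_loop (\<Gamma>\<lparr>arcs := - S\<rparr>) ds"
    then obtain ds where ds: "oriented_loop (\<Gamma>\<lparr>arcs := - S\<rparr>) ds" ..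
    then have "oriented_loop \<Gamma> ds"
      using assms(2) by (simp add: oriented_loop_iff_closed_walk)
    then have "loop_chain ds \<in> H1 \<Gamma>" by (rule loop_chain_in_H1[OF assms(2)])
    then obtain a :: "'l \<Rightarrow> int" where a: "loop_chain ds = (\<Sum>k\<in>UNIV. a k *s loop_chain (L k))"
      using assms(4) unfolding loop_basis_def by (meson ex1_implies_ex)
    have "loop_chain ds $ e = 0" if "e \<in> S" for e
      using ds that by (force simp: oriented_loop_def loop_chain_def)
    then have "(eta L *v (\<chi> k. of_int (a k))) $ b i = 0" for i
      using bS by (simp add: eta_mult_int_vector a[symmetric])
    then have "?M *v (\<chi> k. of_int (a k)) = 0"
      by (simp add: M vec_eq_iff matrix_vector_mult_def)
    then have "(\<chi> k. (of_int (a k) :: real)) = 0" by (rule det_nonzero_imp_kernel_trivial[OF det])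
    then have "loop_chain ds = 0" using a by (simp add: vec_eq_iff)
    moreover have "loop_chain ds $ fst (hd ds) \<noteq> 0"
    proof -
      have "hd ds \<in> set ds" using ds by (simp add: oriented_loop_def)
      then have "(fst (hd ds), snd (hd ds)) \<in> set ds" by simp
      then show ?thesis by (cases "snd (hd ds)") (simp_all add: loop_chain_def del: prod.collapse)
    qed
    ultimately show False by simp
  qed
  then show ?thesis using unit by (cases "spanning_tree_edges \<Gamma> (- S)") auto
qed

text \<open>
  Kirchhoff's theorem. Sets \<open>S\<close> whose complement is a spanning tree have \<open>\<ell>\<close> elements, so the
  sum over spanning trees becomes the Cauchy--Binet sum.
\<close>

theorem Psi_eq_det_tau:
  fixes \<Gamma> :: "('v, 'e::finite) pre_digraph" and L :: "'l::finite \<Rightarrow> ('e \<times> bool) list"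
  assumes "fin_digraph \<Gamma>" "arcs \<Gamma> = UNIV" "Digraph_Component.connected \<Gamma>" "loop_basis \<Gamma> L"
  shows "Psi \<Gamma> t = det (tau L t)"
proof -
  have "Psi \<Gamma> t = (\<Sum>S | spanning_tree_edges \<Gamma> (- S). \<Prod>e\<in>S. t $ e)"
    unfolding Psi_def assms(2)
    by (rule sum.reindex_bij_witness[of _ uminus uminus]) (auto simp: Compl_eq_Diff_UNIV[symmetric])
  also have "\<dots> = (\<Sum>S | card S = CARD('l).
      (\<Prod>e\<in>S. t $ e) * of_bool (spanning_tree_edges \<Gamma> (- S)))"
    by (intro sum.mono_neutral_cong_left) (auto dest: card_complement_spanning_tree[OF assms(1,2,4)])
  also have "\<dots> = det (tau L t)"
    unfolding tau_def det_weighted_gram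
    by (intro sum.cong refl) (simp add: det_rows_of_eta_squared[OF assms])
  finally show ?thesis .
qed

section \<open>The second graph polynomial as a polynomial in matrix entries\<close>

definition matrix_poly_of_degree :: "nat \<Rightarrow> 'l::finite matrix_poly \<Rightarrow> bool" where
  "matrix_poly_of_degree d q \<longleftrightarrow>
     (\<forall>m\<in>Poly_Mapping.keys q. (\<Sum>ij\<in>UNIV. Poly_Mapping.lookup m ij) = d)"

lemma eval_matrix_poly_sum:
  "eval_matrix_poly (\<Sum>i\<in>I. q i) x = (\<Sum>i\<in>I. eval_matrix_poly (q i) x)"
proof (induction I rule: infinite_finite_induct)
  case (insert i I)
  have "eval_matrix_poly (p + q) x = eval_matrix_poly p x + eval_matrix_poly q x" for p q
    unfolding eval_matrix_poly_def by (rule setsum_keys_plus_distrib) (auto simp: distrib_right)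
  then show ?case using insert by simp
qed (auto simp: eval_matrix_poly_def)

lemma eval_matrix_poly_single:
  "eval_matrix_poly (Poly_Mapping.single m c) x
    = c * (\<Prod>(i, j)\<in>UNIV. (x $ i $ j) ^ Poly_Mapping.lookup m (i, j))"
  by (simp add: eval_matrix_poly_def)

lemma matrix_poly_of_degree_sum:
  assumes "\<And>i. i \<in> I \<Longrightarrow> matrix_poly_of_degree d (q i)"
  shows "matrix_poly_of_degree d (\<Sum>i\<in>I. q i)"
  using assms keys_sum[of q I] unfolding matrix_poly_of_degree_def by blast

definition monomial_of :: "('e \<Rightarrow> 'l \<times> 'l) \<Rightarrow> 'e set \<Rightarrow> ('l \<times> 'l) \<Rightarrow>\<^sub>0 nat" where
  "monomial_of f C = (\<Sum>e\<in>C. Poly_Mapping.single (f e) 1)"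

lemma lookup_monomial_of:
  "Poly_Mapping.lookup (monomial_of f C) ij = (\<Sum>e\<in>C. of_bool (f e = ij))"
  by (auto simp: monomial_of_def lookup_sum lookup_single when_def intro!: sum.cong)

lemma degree_monomial_of:
  fixes f :: "'e \<Rightarrow> 'l::finite \<times> 'l"
  assumes "finite C"
  shows "(\<Sum>ij\<in>UNIV. Poly_Mapping.lookup (monomial_of f C) ij) = card C"
  unfolding lookup_monomial_of by (subst sum.swap) (use assms in simp)

lemma eval_monomial_of:
  fixes f :: "'e \<Rightarrow> 'l::finite \<times> 'l"
  shows "(\<Prod>(i, j)\<in>UNIV. (x $ i $ j) ^ Poly_Mapping.lookup (monomial_of f C) (i, j))
    = (\<Prod>e\<in>C. x $ fst (f e) $ snd (f e) :: real)"
proof -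
  have "(\<Prod>(i, j)\<in>UNIV. (x $ i $ j) ^ Poly_Mapping.lookup (monomial_of f C) (i, j))
    = (\<Prod>ij\<in>UNIV. \<Prod>e\<in>C. if f e = ij then x $ fst ij $ snd ij else 1)"
    by (auto simp: lookup_monomial_of power_sum of_bool_def intro!: prod.cong)
  also have "\<dots> = (\<Prod>e\<in>C. x $ fst (f e) $ snd (f e))"
    by (subst prod.swap) simp
  finally show ?thesis .
qed

text \<open>
  Multiplying out gives one monomial for each choice of a matrix entry per factor, all of degree
  \<open>card C\<close>. Writing the polynomial as this sum requires evaluation to be compatible with sums only.
\<close>

lemma product_of_linear_forms_is_matrix_poly:
  fixes g :: "'e \<Rightarrow> real ^ 'l ^ 'l \<Rightarrow> real"
  assumes "finite C" and "\<And>e. e \<in> C \<Longrightarrow> linear (g e)"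
  obtains q :: "'l::finite matrix_poly"
  where "matrix_poly_of_degree (card C) q"
    and "\<And>x. eval_matrix_poly q x = c * (\<Prod>e\<in>C. g e x)"
proof -
  \<comment> \<open>Coefficients of the linear forms: their values on the matrix units.\<close>
  define h where "h e ij = g e (axis (fst ij) (axis (snd ij) 1))" for e and ij :: "'l \<times> 'l"
  have g: "g e x = (\<Sum>ij\<in>UNIV. h e ij * x $ fst ij $ snd ij)" if "e \<in> C" for e x
  proof -
    have "(\<Sum>ij\<in>UNIV. (x $ fst ij $ snd ij) *\<^sub>R axis (fst ij) (axis (snd ij) 1)) $ i $ j = x $ i $ j" for i j
    proof -
      have "(\<Sum>ij\<in>UNIV. (x $ fst ij $ snd ij) *\<^sub>R axis (fst ij) (axis (snd ij) 1)) $ i $ j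
          = (\<Sum>ij\<in>UNIV. if ij = (i, j) then x $ i $ j else 0)"
        unfolding sum_component by (intro sum.cong refl) (auto simp: axis_def)
      then show ?thesis by simp
    qed
    then have "x = (\<Sum>ij\<in>UNIV. (x $ fst ij $ snd ij) *\<^sub>R axis (fst ij) (axis (snd ij) 1))"
      by (simp add: vec_eq_iff)
    then have "g e x = g e (\<Sum>ij\<in>UNIV. (x $ fst ij $ snd ij) *\<^sub>R axis (fst ij) (axis (snd ij) 1))"
      by simp
    also have "\<dots> = (\<Sum>ij\<in>UNIV. (x $ fst ij $ snd ij) * h e ij)"
      using assms(2)[OF that] by (simp add: linear_sum linear_scale h_def)
    finally show ?thesis by (simp add: mult.commute)
  qed
  define q :: "'l matrix_poly" where
    "q = (\<Sum>f\<in>C \<rightarrow>\<^sub>E UNIV. Poly_Mapping.single (monomial_of f C) (c * (\<Prod>e\<in>C. h e (f e))))"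
  show ?thesis
  proof
    show "matrix_poly_of_degree (card C) q"
      unfolding q_def
      by (rule matrix_poly_of_degree_sum)
        (simp add: matrix_poly_of_degree_def degree_monomial_of assms(1))
    fix x
    have "c * (\<Prod>e\<in>C. g e x) = c * (\<Prod>e\<in>C. \<Sum>ij\<in>UNIV. h e ij * x $ fst ij $ snd ij)"
      by (simp add: g)
    also have "\<dots> = eval_matrix_poly q x"
      by (simp add: prod_sum_PiE assms(1) q_def eval_matrix_poly_sum eval_matrix_poly_single
          eval_monomial_of sum_distrib_left prod.distrib mult.assoc)
    finally show "eval_matrix_poly q x = c * (\<Prod>e\<in>C. g e x)" ..
  qed
qed

lemma linear_tau: "linear (tau L)"
proof -
  have "tau L t = (\<chi> k l. \<Sum>e\<in>UNIV. t $ e * (eta L $ e $ k * eta L $ e $ l))" for t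
    by (simp add: tau_def vec_eq_iff matrix_matrix_mult_def transpose_def if_distrib mult_ac cong: if_cong)
  then show ?thesis
    by (intro linearI) (simp_all add: vec_eq_iff sum.distrib distrib_right sum_distrib_left mult.assoc)
qed

text \<open>
  Substitute a linear left inverse of \<open>\<tau>\<close> for \<open>t\<close>. All cut-sets have \<open>\<ell> + 1\<close> edges, hence a common
  degree.
\<close>

lemma P_poly_factors_through_tau:
  fixes \<Gamma> :: "('v, 'e::finite) pre_digraph" and L :: "'l::finite \<Rightarrow> ('e \<times> bool) list"
  assumes "inj (tau L)"
  obtains q :: "'l matrix_poly"
  where "homogeneous_matrix_poly q" "\<And>t. eval_matrix_poly q (tau L t) = P_poly \<Gamma> X att p t"
proof -
  obtain g where g: "linear g" "g \<circ> tau L = id"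
    using linear_injective_left_inverse[OF linear_tau assms] by blast
  have "linear (\<lambda>x. g x $ e)" for e
    using g(1) by (intro linearI) (simp_all add: linear_add linear_scale)
  then have "\<exists>q. matrix_poly_of_degree (card C) q \<and>
      (\<forall>x. eval_matrix_poly q x = of_rat (cut_coeff \<Gamma> X att p C) * (\<Prod>e\<in>C. g x $ e))" for C
    using product_of_linear_forms_is_matrix_poly[of C "\<lambda>e x. g x $ e"] by (metis finite)
  then obtain q where q: "\<And>C. matrix_poly_of_degree (card C) (q C)"
    "\<And>C x. eval_matrix_poly (q C) x = of_rat (cut_coeff \<Gamma> X att p C) * (\<Prod>e\<in>C. g x $ e)"
    by metis
  let ?q = "\<Sum>C | cut_set \<Gamma> C. q C"
  have "matrix_poly_of_degree (loop_number \<Gamma> + 1) ?q"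
    using q(1) by (intro matrix_poly_of_degree_sum) (metis cut_set_def mem_Collect_eq)
  then have "homogeneous_matrix_poly ?q"
    unfolding homogeneous_matrix_poly_def matrix_poly_of_degree_def by blast
  moreover have "eval_matrix_poly ?q (tau L t) = P_poly \<Gamma> X att p t" for t
    using g(2) by (simp add: eval_matrix_poly_sum q(2) P_poly_def fun_eq_iff)
  ultimately show ?thesis using that by blast
qed

section \<open>The change of variables\<close>

text \<open>
  The transformation rule for image measures demands a Borel measurable integrand on the whole
  matrix space.
\<close>

lemma borel_measurable_eval_matrix_poly [measurable]: "eval_matrix_poly q \<in> borel_measurable borel"
  unfolding eval_matrix_poly_def
  by (intro borel_measurable_continuous_onI) (auto intro!: continuous_intros simp: case_prod_beta)

lemma borel_measurable_det [measurable]: "(det :: real ^ 'l ^ 'l::finite \<Rightarrow> real) \<in> borel_measurable borel"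
  unfolding det_def by (intro borel_measurable_continuous_onI continuous_intros)

lemma borel_measurable_rpow [measurable (raw)]:
  assumes "f \<in> borel_measurable M"
  shows "(\<lambda>x. rpow (f x) a) \<in> borel_measurable M"
  using assms by (cases "a = 0") (auto simp: rpow_def)

lemma sets_omega_n [simp, measurable_cong]: "sets (omega_n e0) = sets borel"
  by (simp add: omega_n_def)

lemma compact_sigma_simplex: "compact (sigma_simplex :: (real ^ 'e::finite) set)"
proof -
  have "closed (sigma_simplex :: (real ^ 'e) set)"
    unfolding sigma_simplex_def by (intro closed_Collect_conj closed_Collect_all closed_Collect_le closed_Collect_eq continuous_intros)
  moreover have "sigma_simplex \<subseteq> cbox (0 :: real ^ 'e) 1"
  proof
    fix t :: "real ^ 'e" assume t: "t \<in> sigma_simplex"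
    then have "t $ i \<le> (\<Sum>i\<in>UNIV. t $ i)" for i
      by (intro member_le_sum) (auto simp: sigma_simplex_def)
    then show "t \<in> cbox 0 1" using t by (auto simp: sigma_simplex_def mem_box_cart)
  qed
  ultimately show ?thesis by (meson bounded_cbox bounded_subset compact_eq_bounded_closed)
qed

text \<open>
  The transformation rule for image measures. Injectivity lets the indicator function of the image
  of the simplex pull back to that of the simplex, and compactness makes the image a Borel set.
\<close>

lemma set_integral_image_measure:
  fixes L :: "'l::finite \<Rightarrow> ('e::finite \<times> bool) list" and h :: "real ^ 'l ^ 'l \<Rightarrow> real"
  assumes "inj (tau L)" and [measurable]: "h \<in> borel_measurable borel"
  shows "set_integrable (omega_n e0) sigma_simplex (\<lambda>t. h (tau L t)) \<longleftrightarrow>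
      set_integrable (omega_Gamma L e0) (tau L ` sigma_simplex) h"
    and "(LINT t:sigma_simplex|omega_n e0. h (tau L t)) =
      (LINT x:tau L ` sigma_simplex|omega_Gamma L e0. h x)"
proof -
  have cont: "continuous_on A (tau L)" for A
    by (simp add: linear_continuous_on linear_conv_bounded_linear[symmetric] linear_tau)
  have [measurable]: "tau L \<in> borel_measurable (omega_n e0)"
    using borel_measurable_continuous_onI[OF cont] by simp
  have [measurable]: "tau L ` sigma_simplex \<in> sets borel"
    by (intro borel_compact compact_continuous_image cont compact_sigma_simplex)
  have ind: "indicator (tau L ` sigma_simplex) (tau L t) = (indicator sigma_simplex t :: real)" for t
    using assms(1) by (auto simp: indicator_def inj_image_mem_iff)
  show "set_integrable (omega_n e0) sigma_simplex (\<lambda>t. h (tau L t)) \<longleftrightarrow>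
      set_integrable (omega_Gamma L e0) (tau L ` sigma_simplex) h"
    unfolding set_integrable_def omega_Gamma_def by (subst integrable_distr_eq) (auto simp: ind)
  show "(LINT t:sigma_simplex|omega_n e0. h (tau L t)) =
      (LINT x:tau L ` sigma_simplex|omega_Gamma L e0. h x)"
    unfolding set_lebesgue_integral_def omega_Gamma_def by (subst integral_distr) (auto simp: ind)
qed

theorem lemma2p3:
  fixes \<Gamma> :: "('v, 'e::finite) pre_digraph"
    and X :: "'x set" and att :: "'x \<Rightarrow> 'v" and p :: "'x \<Rightarrow> rat ^ 'd::finite"
    and L :: "'l::finite \<Rightarrow> ('e \<times> bool) list"
    and e0 :: 'e and n ell D :: real
  assumes "feynman_graph \<Gamma> X att"
    and "(\<Sum>e\<in>X. p e) = 0"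
    and "loop_basis \<Gamma> L"
    and "n = real CARD('e)" and "ell = real (loop_number \<Gamma>)" and "D = real CARD('d)"
    and "n \<le> D * ell / 2"
    and "inj (tau L)"
  shows "\<exists>\<P> :: 'l matrix_poly.
    homogeneous_matrix_poly \<P> \<and>
    (\<forall>t. eval_matrix_poly \<P> (tau L t) = P_poly \<Gamma> X att p t) \<and>
    (set_integrable (omega_n e0) sigma_simplex
        (\<lambda>t. rpow (P_poly \<Gamma> X att p t) (- n + D * ell / 2) / rpow (Psi \<Gamma> t) (- n + (ell + 1) * D / 2))
      \<longleftrightarrow>
     set_integrable (omega_Gamma L e0) (tau L ` sigma_simplex)
        (\<lambda>x. rpow (eval_matrix_poly \<P> x) (- n + D * ell / 2) / rpow (det x) (- n + (ell + 1) * D / 2))) \<and>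
    (LINT t:sigma_simplex|omega_n e0.
        rpow (P_poly \<Gamma> X att p t) (- n + D * ell / 2) / rpow (Psi \<Gamma> t) (- n + (ell + 1) * D / 2))
    = (LINT x:tau L ` sigma_simplex|omega_Gamma L e0.
        rpow (eval_matrix_poly \<P> x) (- n + D * ell / 2) / rpow (det x) (- n + (ell + 1) * D / 2))"
proof -
  have graph: "fin_digraph \<Gamma>" "arcs \<Gamma> = UNIV" "Digraph_Component.connected \<Gamma>"
    using assms(1) by (simp_all add: feynman_graph_def)
  obtain \<P> :: "'l matrix_poly" where hom: "homogeneous_matrix_poly \<P>"
    and eval: "\<And>t. eval_matrix_poly \<P> (tau L t) = P_poly \<Gamma> X att p t"
    using P_poly_factors_through_tau[OF assms(8)] by blast
  let ?h = "\<lambda>x. rpow (eval_matrix_poly \<P> x) (- n + D * ell / 2) / rpow (det x) (- n + (ell + 1) * D / 2)"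
  have h: "?h \<in> borel_measurable borel" by measurable
  have pullback: "rpow (P_poly \<Gamma> X att p t) (- n + D * ell / 2) / rpow (Psi \<Gamma> t) (- n + (ell + 1) * D / 2)
      = ?h (tau L t)" for t
    by (simp add: eval Psi_eq_det_tau[OF graph assms(3)])
  show ?thesis
    unfolding pullback using hom eval set_integral_image_measure[OF assms(8) h]
    by (intro exI[of _ \<P>]) simp
qed

end
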